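(* Let $p$ be an odd prime, let $s,h,t,r$ be positive integers with $t\mid h$, $s\le h$, $\gcd(r,p)=1$, and let $q=p^h$. Assume that $\mathbb{F}_q$ is the splitting field of $g(x)=x^{2rp^s}+bx^{2rp^s-1}+c$ ($b,c\ne0$) over $\mathbb{F}_{p^t}$, that $\alpha_1,\dots,\alpha_{2rp^s}$ are all the roots of $g(x)$, and let $v_i=\alpha_i^{1-rp^s}$ for $1\le i\le2rp^s$. Let $\boldsymbol{\alpha}=(\alpha_1,\dots,\alpha_{2rp^s})$, $\boldsymbol{v}=(v_1,\dots,v_{2rp^s})$, $\eta_{12},\eta_{22}\in\mathbb{F}_q^*$, and $$\mathcal{S}_1=\Big\{\sum_{i=0}^{rp^s-2}f_ix^i+\sum_{i=1}^2f_{rp^s-4+i}\,\eta_{i2}\Big(\frac b2x^{rp^s-1}+x^{rp^s}\Big): f_i\in\mathbb{F}_q\text{ for }0\le i\le rp^s-2\Big\},$$ and let $\mathcal{C}_1=ev_{\boldsymbol{\alpha},\boldsymbol{v}}(\mathcal{S}_1)$. Then there exists a $[[2rp^s,\,2,\,\mathrm{wt}(\mathcal{C}_1^\perp\setminus\mathcal{C}_1)]]_q$ quantum stabilizer code.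
   Context: Here $b,c\in\mathbb{F}_{p^t}$. $ev_{\boldsymbol{\alpha},\boldsymbol{v}}(f)=(v_1f(\alpha_1),\dots,v_nf(\alpha_n))$. $\mathcal{C}^\perp$ is the Euclidean dual. For a set $X$ of vectors, $\mathrm{wt}(X)$ is the minimum Hamming weight of a nonzero element of $X$. Quantum codes: let $q=p^h$, $\zeta=e^{2\pi i/p}$, $\mathrm{Tr}:\mathbb{F}_q\to\mathbb{F}_p$ the trace; on $\mathbb{C}^q$ with orthonormal basis $\{|x\rangle:x\in\mathbb{F}_q\}$ let $X(a)|x\rangle=|x+a\rangle$, $Z(b)|x\rangle=\zeta^{\mathrm{Tr}(bx)}|x\rangle$, and for $\boldsymbol{a},\boldsymbol{b}\in\mathbb{F}_q^n$ let $X(\boldsymbol{a})=\bigotimes X(a_i)$, $Z(\boldsymbol{b})=\bigotimes Z(b_i)$ on $(\mathbb{C}^q)^{\otimes n}$. The error group consists of all $\zeta^cX(\boldsymbol{a})Z(\boldsymbol{b})$; the weight of such an element is the number of $i$ with $(a_i,b_i)\neq(0,0)$. A stabilizer code is a nonzero joint $+1$-eigenspace of an abelian subgroup of the error group. It is an $[[n,K,d]]_q$ code if it has dimension $q^K$ and minimum distance $d$, i.e. $d$ is the largest integer such that every error $E$ of weight less than $d$ is detectable ($PEP=c_EP$ for a scalar $c_E$, $P$ the orthogonal projector onto the code). *)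

theory Defs
  imports
    "HOL-Algebra.Generated_Fields"
    "HOL-Algebra.Algebraic_Closure_Type"
    "HOL-Computational_Algebra.Computational_Algebra"
    "HOL-Analysis.Analysis"
begin

section \<open>Splitting fields\<close>

definition splits :: "'a::field poly \<Rightarrow> bool" where
  "splits g \<longleftrightarrow> (\<exists>A. g = smult (lead_coeff g) (\<Prod>a\<in>#A. [:- a, 1:]))"

text \<open>The whole type \<open>'a\<close> is a splitting field of \<open>g\<close> over its subfield \<open>F\<close>.\<close>

definition is_splitting_field :: "'a::field set \<Rightarrow> 'a poly \<Rightarrow> bool" where
  "is_splitting_field F g \<longleftrightarrow>
     subfield F (ring_of_type_algebra :: 'a ring) \<and>
     (\<forall>i. poly.coeff g i \<in> F) \<and>
     splits g \<and>
     generate_field (ring_of_type_algebra :: 'a ring) (F \<union> {x. poly g x = 0}) = UNIV"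

section \<open>Classical codes\<close>

text \<open>
  Words of length \<open>n\<close> are vectors over a finite index type \<open>'n\<close> with \<open>CARD('n) = n\<close>.
\<close>

definition ev :: "'a::field ^ 'n \<Rightarrow> 'a ^ 'n \<Rightarrow> 'a poly \<Rightarrow> 'a ^ 'n" where
  "ev \<alpha> v f = (\<chi> i. v $ i * poly f (\<alpha> $ i))"

definition euclidean_dual :: "('a::field ^ 'n) set \<Rightarrow> ('a ^ 'n) set" where
  "euclidean_dual C = {x. \<forall>y\<in>C. (\<Sum>i\<in>UNIV. x $ i * y $ i) = 0}"

definition hamming_weight :: "'a::zero ^ 'n \<Rightarrow> nat" where
  "hamming_weight x = card {i. x $ i \<noteq> 0}"

text \<open>Meaningful for sets that contain a nonzero vector.\<close>

definition min_weight :: "('a::zero ^ 'n) set \<Rightarrow> nat" where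
  "min_weight A = Min (hamming_weight ` (A - {0}))"

section \<open>Quantum stabilizer codes\<close>

text \<open>
  The field \<open>'a\<close> is meant to have \<open>p ^ h\<close> elements.  The trace takes values in the prime
  field, seen inside \<open>'a\<close>, and \<open>prime_field_rep\<close> turns such a value into its least
  nonnegative integer representative, so that it can be used as an exponent of \<open>\<zeta>\<close>.
\<close>

definition field_trace :: "nat \<Rightarrow> nat \<Rightarrow> 'a::field \<Rightarrow> 'a" where
  "field_trace p h x = (\<Sum>i<h. x ^ (p ^ i))"

definition prime_field_rep :: "'a::field \<Rightarrow> nat" where
  "prime_field_rep y = (LEAST k. of_nat k = y)"

definition zeta :: "nat \<Rightarrow> complex" where
  "zeta p = exp (2 * of_real pi * \<i> / of_nat p)"

type_synonym 'm state = "(complex, 'm) vec"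
type_synonym 'm operator = "((complex, 'm) vec, 'm) vec"

text \<open>
  Operators on \<open>\<complex>\<^sup>q\<close> are matrices whose rows and columns are indexed by the field; column \<open>x\<close> is
  the image of the basis vector \<open>|x\<rangle>\<close>, which is \<open>axis x 1\<close>.
\<close>

definition shift_op :: "'a::{field,finite} \<Rightarrow> 'a operator" where
  "shift_op a = (\<chi> y x. if y = x + a then 1 else 0)"

definition phase_op :: "nat \<Rightarrow> nat \<Rightarrow> 'a::{field,finite} \<Rightarrow> 'a operator" where
  "phase_op p h b =
     (\<chi> y x. if y = x then zeta p ^ prime_field_rep (field_trace p h (b * x)) else 0)"

text \<open>
  The \<open>n\<close>-fold tensor power of \<open>\<complex>\<^sup>q\<close> has the basis \<open>|x\<^sub>1\<rangle> \<otimes> \<dots> \<otimes> |x\<^sub>n\<rangle>\<close> indexed by the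
  vectors \<open>x :: 'a ^ 'n\<close>; the entries of a tensor product of matrices are products of entries.
\<close>

definition tensor_op ::
  "('n \<Rightarrow> 'a operator) \<Rightarrow> ('a::{field,finite} ^ 'n::finite) operator" where
  "tensor_op M = (\<chi> y x. \<Prod>i\<in>UNIV. M i $ (y $ i) $ (x $ i))"

text \<open>The error \<open>\<zeta>\<^sup>c X(a) Z(b)\<close>; multiplication by \<open>mat z\<close> is multiplication by the scalar \<open>z\<close>.\<close>

definition error_op ::
  "nat \<Rightarrow> nat \<Rightarrow> nat \<Rightarrow> 'a::{field,finite} ^ 'n \<Rightarrow> 'a ^ 'n
     \<Rightarrow> ('a ^ 'n::finite) operator" where
  "error_op p h c a b =
     mat (zeta p ^ c) ** tensor_op (\<lambda>i. shift_op (a $ i)) ** tensor_op (\<lambda>i. phase_op p h (b $ i))"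

lemma prod_if_zero:
  fixes f :: "'n::finite \<Rightarrow> complex"
  shows "(\<Prod>i\<in>UNIV. if P i then f i else 0) = (if \<forall>i. P i then \<Prod>i\<in>UNIV. f i else 0)"
  by (cases "\<forall>i. P i") auto

lemma operator_axis: "(A :: ('m::finite) operator) *v axis x 1 = column x A"
  by (simp add: matrix_vector_mult_def axis_def column_def vec_eq_iff if_distrib cong: if_cong)

lemma tensor_shift_axis:
  fixes a :: "'a::{field,finite} ^ 'n::finite"
  shows "tensor_op (\<lambda>i. shift_op (a $ i)) *v axis x 1 = axis (x + a) 1"
  unfolding operator_axis
  by (auto simp: vec_eq_iff tensor_op_def shift_op_def column_def axis_def prod_if_zero)

lemma tensor_phase_axis:
  fixes b :: "'a::{field,finite} ^ 'n::finite"
  shows "tensor_op (\<lambda>i. phase_op p h (b $ i)) *v axis x 1 =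
    (\<Prod>i\<in>UNIV. zeta p ^ prime_field_rep (field_trace p h (b $ i * x $ i))) *s axis x 1"
  unfolding operator_axis
  by (auto simp: vec_eq_iff tensor_op_def phase_op_def column_def axis_def prod_if_zero
      simp del: power_sum)

definition error_weight :: "'a::{field,finite} ^ 'n \<Rightarrow> 'a ^ 'n \<Rightarrow> nat" where
  "error_weight a b = card {i. (a $ i, b $ i) \<noteq> (0, 0)}"

definition error_group ::
  "nat \<Rightarrow> nat \<Rightarrow> ('a::{field,finite} ^ 'n::finite) operator monoid" where
  "error_group p h =
     \<lparr>carrier = {error_op p h c a b | c a b. True}, monoid.mult = (**), one = mat 1\<rparr>"

definition joint_eigenspace :: "'m operator set \<Rightarrow> ('m::finite) state set" where
  "joint_eigenspace S = {u. \<forall>E\<in>S. E *v u = u}"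

definition is_stabilizer_code ::
  "nat \<Rightarrow> nat \<Rightarrow> ('a::{field,finite} ^ 'n::finite) state set \<Rightarrow> bool" where
  "is_stabilizer_code p h Q \<longleftrightarrow>
     (\<exists>S. subgroup S (error_group p h) \<and>
          comm_group ((error_group p h)\<lparr>carrier := S\<rparr>) \<and>
          Q = joint_eigenspace S \<and> Q \<noteq> {0})"

definition is_orthogonal_projector ::
  "'m operator \<Rightarrow> ('m::finite) state set \<Rightarrow> bool" where
  "is_orthogonal_projector P Q \<longleftrightarrow>
     P ** P = P \<and> (\<forall>i j. P $ i $ j = cnj (P $ j $ i)) \<and> range (\<lambda>u. P *v u) = Q"

definition detectable ::
  "('m::finite) state set \<Rightarrow> 'm operator \<Rightarrow> bool" where
  "detectable Q E \<longleftrightarrow>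
     (\<exists>P. is_orthogonal_projector P Q \<and> (\<exists>c. P ** E ** P = mat c ** P))"

definition detects_below ::
  "nat \<Rightarrow> nat \<Rightarrow> ('a::{field,finite} ^ 'n::finite) state set \<Rightarrow> nat \<Rightarrow> bool" where
  "detects_below p h Q d \<longleftrightarrow>
     (\<forall>c (a :: 'a ^ 'n) b. error_weight a b < d \<longrightarrow> detectable Q (error_op p h c a b))"

definition is_min_distance ::
  "nat \<Rightarrow> nat \<Rightarrow> ('a::{field,finite} ^ 'n::finite) state set \<Rightarrow> nat \<Rightarrow> bool" where
  "is_min_distance p h Q d \<longleftrightarrow>
     detects_below p h Q d \<and> (\<forall>d'. detects_below p h Q d' \<longrightarrow> d' \<le> d)"

text \<open>\<open>Q\<close> is an \<open>[[n, K, d]]\<close> stabilizer code over the field \<open>'a\<close> with \<open>q = p ^ h\<close> elements.\<close>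

definition quantum_stabilizer_code ::
  "nat \<Rightarrow> nat \<Rightarrow> nat \<Rightarrow> nat \<Rightarrow> nat
     \<Rightarrow> ('a::{field,finite} ^ 'n::finite) state set \<Rightarrow> bool" where
  "quantum_stabilizer_code p h n K d Q \<longleftrightarrow>
     CARD('a) = p ^ h \<and> CARD('n) = n \<and>
     is_stabilizer_code p h Q \<and>
     vec.dim Q = (p ^ h) ^ K \<and>
     is_min_distance p h Q d"

end

(*
  The weights satisfy v_i^2 = - b / g'(alpha_i), because g' = - b x^(2m-2) in characteristic p.
  By Lagrange interpolation, the sum of f(a) / g'(a) over the roots a of g is a combination of the
  two top coefficients of f (for deg f <= deg g); for a product of two elements of S1 it vanishes,
  so C1 is Euclidean self-orthogonal, of dimension m - 1. The stabilizer { X(a) Z(b) | a, b in C1 }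
  fixes exactly the states that are supported on the dual of C1 and constant on the cosets of C1;
  character sums over C1 give the dimension q^(n - 2 (m - 1)) = q^2 and decide which errors are
  detectable.
*)
theory Submission
  imports Defs "HOL-Number_Theory.Cong"
begin

section \<open>The additive character of a finite field\<close>

text \<open>Everything rests on p dividing m = r p^s: then 2m = 0 and 2m - 1 = -1 in the field, so
  only the term of degree 2m - 1 survives differentiation. As c is nonzero, 0 is no root, hence g'
  vanishes at no root and g has 2m distinct roots. The constant b/2 is dictated by g: two elements
  of S1 with coefficients u, u' at x^m have u b/2, u' b/2 at x^(m-1), so their product has u u' at
  x^(2m) and u u' b at x^(2m-1). Subtracting u u' g cancels both at once. Halving needs p odd. On
  the quantum side, X(a)Z(b) and X(a')Z(b') commute up to a phase that depends on the products of b
  with a' and of b' with a. Self-orthogonality makes both zero, so products of stabilizer elements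
  never acquire a phase that would have to be tracked. Sizes of finite sets replace dimensions over
  the finite field: double counting a character sum relates the size of C1 to that of its dual, and
  the complex dimension of the code is the number of cosets of C1 in the dual.\<close>

lemma power_card_eq_same:
  fixes x :: "'a::{field,finite}"
  shows "x ^ CARD('a) = x"
proof (cases "x = 0")
  case False
  have "x * (\<Prod>y\<in>UNIV-{0}. x * y) = x * x ^ (CARD('a) - 1) * \<Prod>(UNIV-{0})"
    by (simp add: prod.distrib mult_ac)
  also have "x * x ^ (CARD('a) - 1) = x ^ CARD('a)"
    by (metis One_nat_def Suc_pred power_Suc zero_less_card_finite)
  also have "(\<Prod>y\<in>UNIV-{0}. x * y) = (\<Prod>y\<in>UNIV-{0}. y)"
    by (rule prod.reindex_bij_witness[of _ "\<lambda>y. y / x" "\<lambda>y. x * y"]) (use False in auto)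
  finally show ?thesis
    by simp
qed auto

lemma zeta_power_eq_iff:
  assumes "p > 0"
  shows "zeta p ^ j = zeta p ^ k \<longleftrightarrow> [j = k] (mod p)"
proof -
  have "zeta p ^ l = exp (2 * of_real pi * \<i> * of_nat l / of_nat p)" for l
    unfolding zeta_def by (subst exp_of_nat_mult [symmetric]) (simp add: mult_ac)
  then show ?thesis
    using assms by (auto simp: complex_root_unity_eq unique_euclidean_semiring_class.cong_def)
qed

section \<open>The standard bilinear form on words\<close>

definition dot :: "'a::field ^ 'n \<Rightarrow> 'a ^ 'n \<Rightarrow> 'a" where
  "dot x y = (\<Sum>i\<in>UNIV. x $ i * y $ i)"

lemma dot_commute: "dot x y = dot y x"
  by (simp add: dot_def mult.commute)

lemma dot_add_right: "dot x (y + z) = dot x y + dot x z"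
  by (simp add: dot_def distrib_left sum.distrib)

lemma dot_diff_right: "dot x (y - z) = dot x y - dot x z"
  by (simp add: dot_def right_diff_distrib sum_subtractf)

lemma dot_add_left: "dot (x + y) z = dot x z + dot y z"
  by (simp add: dot_def distrib_right sum.distrib)

lemma dot_scale_right: "dot x (k *s y) = k * dot x y"
  by (simp add: dot_def sum_distrib_left mult_ac)

lemma dot_zero [simp]: "dot x 0 = 0" "dot 0 x = 0"
  by (simp_all add: dot_def)

lemma dot_uminus_left: "dot (- x) y = - dot x y"
  by (simp add: dot_def sum_negf)

lemma dot_axis: "dot (x :: 'a::field ^ 'n::finite) (axis i 1) = x $ i"
  by (simp add: dot_def axis_def if_distrib cong: if_cong)

lemma mem_euclidean_dual: "x \<in> euclidean_dual C \<longleftrightarrow> (\<forall>y\<in>C. dot x y = 0)"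
  by (simp add: euclidean_dual_def dot_def)

lemma subspace_euclidean_dual: "vec.subspace (euclidean_dual C)"
  by (auto simp: vec.subspace_def mem_euclidean_dual dot_add_left)
    (simp add: dot_commute[of "_ *s _"] dot_commute dot_scale_right)

section \<open>Characteristic, trace and additive character of the field with p^h elements\<close>

locale galois_field =
  fixes p h :: nat and type :: "'a::{field,finite} itself"
  assumes prime_p: "prime p"
    and card_field: "CARD('a) = p ^ h"
begin

lemma h_pos: "h > 0"
proof (rule ccontr)
  assume "\<not> h > 0"
  then have "CARD('a) = 1"
    using card_field by simp
  then obtain z :: 'a where "UNIV = {z}"
    by (rule card_1_singletonE)
  then show False
    by (metis UNIV_I singletonD zero_neq_one)
qed

lemma p_gt_1: "p > 1"
  using prime_p prime_gt_1_nat by blast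

text \<open>Translation by 1 permutes the field, so comparing the sums of \<open>x + 1\<close> and
  of \<open>x\<close> gives p^h = 0 in the field; the characteristic is a prime dividing
  p^h.\<close>

lemma CHAR_eq: "CHAR('a) = p"
proof -
  have "CHAR('a) > 0"
    by (rule finite_imp_CHAR_pos) simp
  then have prime: "prime CHAR('a)"
    by (rule prime_CHAR_semidom)
  have "(\<Sum>x\<in>(UNIV :: 'a set). x + 1) = (\<Sum>x\<in>UNIV. x)"
    by (rule sum.reindex_bij_witness[of _ "\<lambda>x. x - 1" "\<lambda>x. x + 1"]) auto
  then have "(of_nat (p ^ h) :: 'a) = 0"
    by (simp add: sum.distrib flip: card_field)
  then have "CHAR('a) dvd p ^ h"
    by (simp only: of_nat_eq_0_iff_char_dvd)
  then show ?thesis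
    using prime prime_p by (metis prime_dvd_power primes_dvd_imp_eq)
qed

lemma prime_CHAR: "prime CHAR('a)"
  using CHAR_eq prime_p by simp

abbreviation tr :: "'a \<Rightarrow> 'a" where "tr \<equiv> field_trace p h"

lemma trace_add: "tr (x + y) = tr x + tr y"
  by (simp add: field_trace_def sum.distrib freshmans_dream'[OF prime_CHAR] CHAR_eq)

text \<open>Frobenius shifts the summands of the trace cyclically, because
  \<open>x ^ (p ^ h) = x\<close> closes the cycle.\<close>

lemma trace_power_p: "tr x ^ p = tr x"
proof -
  have "tr x ^ p = (\<Sum>i<h. (x ^ (p ^ i)) ^ p)"
    unfolding field_trace_def by (rule freshmans_dream_sum[OF prime_CHAR CHAR_eq[symmetric]])
  also have "\<dots> = (\<Sum>i<h. x ^ (p ^ Suc i))"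
    by (simp add: power_mult [symmetric] mult.commute)
  also have "\<dots> = (\<Sum>i<h. x ^ (p ^ i)) + x ^ (p ^ h) - x ^ (p ^ 0)"
    using sum.lessThan_Suc_shift[of "\<lambda>i. x ^ (p ^ i)" h] by simp
  also have "\<dots> = tr x"
    using power_card_eq_same[of x] card_field by (simp add: field_trace_def)
  finally show ?thesis .
qed

text \<open>The polynomial X^p - X has at most p roots, and the p images of 0, ..., p - 1 already
  are roots.\<close>

lemma fixed_by_frobenius:
  fixes y :: 'a
  assumes "y ^ p = y"
  shows "y \<in> range of_nat"
proof -
  define f :: "'a poly" where "f = monom 1 p - monom 1 1"
  have "poly.coeff f p = 1"
    using p_gt_1 by (simp add: f_def)
  then have "f \<noteq> 0"
    by auto
  have "degree f \<le> p"
    unfolding f_def using p_gt_1 by (intro degree_diff_le) (auto simp: degree_monom_eq)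
  then have le: "card {x. poly f x = 0} \<le> p"
    using card_poly_roots_bound[OF \<open>f \<noteq> 0\<close>] by linarith
  have roots: "poly f x = 0 \<longleftrightarrow> x ^ p = x" for x
    by (simp add: f_def poly_monom)
  have frob_nat: "(of_nat k :: 'a) ^ p = of_nat k" for k
  proof (induction k)
    case 0
    then show ?case using p_gt_1 by simp
  next
    case (Suc k)
    then show ?case
      using freshmans_dream[OF prime_CHAR CHAR_eq[symmetric], of 1 "of_nat k"] by simp
  qed
  have "card (of_nat ` {..<p} :: 'a set) = p"
    by (subst card_image) (auto intro!: inj_onI simp: of_nat_eq_iff_cong_CHAR CHAR_eq cong_def)
  then have "(of_nat ` {..<p} :: 'a set) = {x. poly f x = 0}"
    using le by (intro card_seteq) (auto simp: roots frob_nat)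
  then show ?thesis
    using assms by (auto simp: roots)
qed

text \<open>The \<open>LEAST\<close> in \<open>prime_field_rep\<close> is meaningful only on the
  image of the naturals; trace values lie there because Frobenius fixes them.\<close>

lemma of_nat_prime_field_rep: "of_nat (prime_field_rep (tr x)) = tr x"
proof -
  obtain k where "of_nat k = tr x"
    using fixed_by_frobenius[OF trace_power_p] by (metis imageE)
  then show ?thesis
    unfolding prime_field_rep_def by (rule LeastI)
qed

text \<open>The trace is a polynomial function of degree at most p^(h-1), too small to vanish on all
  p^h elements; its coefficient 1 at X shows that the polynomial is nonzero.\<close>

lemma ex_trace_nonzero: "\<exists>x. tr x \<noteq> 0"
proof (rule ccontr)
  assume "\<not> ?thesis"
  define f :: "'a poly" where "f = (\<Sum>i<h. monom 1 (p ^ i))"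
  have "poly f x = tr x" for x
    by (simp add: f_def field_trace_def poly_sum poly_monom)
  with \<open>\<not> ?thesis\<close> have all: "{x. poly f x = 0} = UNIV"
    by auto
  have "poly.coeff f 1 = (\<Sum>i<h. if i = 0 then 1 else 0)"
    unfolding f_def coeff_sum using p_gt_1
    by (intro sum.cong) auto
  also have "\<dots> = 1"
    using h_pos by simp
  finally have "f \<noteq> 0"
    by auto
  then have "p ^ h \<le> degree f"
    using card_poly_roots_bound[of f] all card_field by simp
  moreover have "degree f \<le> p ^ (h - 1)"
    unfolding f_def using p_gt_1
    by (intro degree_sum_le) (auto simp: degree_monom_eq intro!: power_increasing)
  moreover have "p ^ (h - 1) < p ^ h"
    using p_gt_1 h_pos by (intro power_strict_increasing) auto
  ultimately show False
    by simp
qed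

text \<open>The canonical additive character: the diagonal entry of \<open>phase_op p h b\<close> at
  \<open>x\<close> is \<open>chi (b * x)\<close>.\<close>

definition chi :: "'a \<Rightarrow> complex" where
  "chi x = zeta p ^ prime_field_rep (tr x)"

text \<open>The integer representatives of traces add up only modulo \<open>p\<close>, which is all
  that an exponent of \<open>zeta p\<close> sees.\<close>

lemma chi_add: "chi (x + y) = chi x * chi y"
proof -
  have "(of_nat (prime_field_rep (tr (x + y))) :: 'a) =
    of_nat (prime_field_rep (tr x) + prime_field_rep (tr y))"
    by (simp only: of_nat_prime_field_rep of_nat_add) (rule trace_add)
  then have "[prime_field_rep (tr (x + y)) = prime_field_rep (tr x) + prime_field_rep (tr y)] (mod p)"
    by (simp only: of_nat_eq_iff_cong_CHAR CHAR_eq)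
  then show ?thesis
    using p_gt_1 by (simp add: chi_def power_add [symmetric] zeta_power_eq_iff)
qed

lemma chi_eq_1_iff: "chi x = 1 \<longleftrightarrow> tr x = 0"
proof -
  have "chi x = 1 \<longleftrightarrow> zeta p ^ prime_field_rep (tr x) = zeta p ^ 0"
    by (simp add: chi_def)
  also have "\<dots> \<longleftrightarrow> (of_nat (prime_field_rep (tr x)) :: 'a) = of_nat 0"
    using p_gt_1 by (subst zeta_power_eq_iff) (auto simp only: of_nat_eq_iff_cong_CHAR CHAR_eq)
  finally show ?thesis
    by (simp add: of_nat_prime_field_rep)
qed

lemma chi_0 [simp]: "chi 0 = 1"
  using p_gt_1 by (simp add: chi_eq_1_iff field_trace_def power_0_left)

lemma ex_chi_neq_1: "\<exists>x. chi x \<noteq> 1"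
  using ex_trace_nonzero by (simp add: chi_eq_1_iff)

lemma chi_sum: "chi (sum f A) = (\<Prod>i\<in>A. chi (f i))"
  by (induction A rule: infinite_finite_induct) (auto simp: chi_add)

text \<open>\<open>chi\<close> sees only the trace of \<open>dot x y\<close>, so a nonzero product
  alone is not enough. As \<open>C\<close> is closed under scaling by the whole field,
  \<open>y\<close> can be rescaled until the product is any prescribed \<open>z\<close>.\<close>

lemma ex_chi_dot_neq_1:
  fixes C :: "('a ^ 'n::finite) set"
  assumes C: "vec.subspace C" and "x \<notin> euclidean_dual C"
  shows "\<exists>y\<in>C. chi (dot x y) \<noteq> 1"
proof -
  obtain y where y: "y \<in> C" "dot x y \<noteq> 0"
    using assms(2) by (auto simp: mem_euclidean_dual)
  obtain z where "chi z \<noteq> 1"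
    using ex_chi_neq_1 by blast
  then have "chi (dot x ((z / dot x y) *s y)) \<noteq> 1"
    using y by (simp add: dot_scale_right)
  then show ?thesis
    using C y by (metis vec.subspace_scale)
qed

text \<open>Translating the summation variable by some \<open>z\<close> in \<open>C\<close>
  multiplies the sum by \<open>chi (dot x z)\<close>; if this factor can differ from 1, the sum is
  zero.\<close>

lemma character_sum:
  fixes C :: "('a ^ 'n::finite) set"
  assumes C: "vec.subspace C"
  shows "(\<Sum>y\<in>C. chi (dot x y)) = (if x \<in> euclidean_dual C then of_nat (card C) else 0)"
proof (cases "x \<in> euclidean_dual C")
  case True
  then show ?thesis by (simp add: mem_euclidean_dual)
next
  case False
  then obtain z where z: "z \<in> C" "chi (dot x z) \<noteq> 1"
    using ex_chi_dot_neq_1[OF C] by blast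
  have "(\<Sum>y\<in>C. chi (dot x y)) = (\<Sum>y\<in>C. chi (dot x (z + y)))"
    using C z(1)
    by (intro sum.reindex_bij_witness[of _ "\<lambda>y. z + y" "\<lambda>y. y - z"])
      (auto intro: vec.subspace_add vec.subspace_diff)
  also have "\<dots> = chi (dot x z) * (\<Sum>y\<in>C. chi (dot x y))"
    by (simp add: dot_add_right chi_add sum_distrib_left)
  finally show ?thesis
    using z(2) False by auto
qed

text \<open>Double counting of \<open>chi (dot x y)\<close> over all words \<open>x\<close> and all
  \<open>y\<close> in \<open>C\<close>: summing over \<open>y\<close> first leaves only
  \<open>x\<close> in the dual, summing over \<open>x\<close> first leaves only
  \<open>y = 0\<close>.\<close>

lemma card_euclidean_dual:
  fixes C :: "('a ^ 'n::finite) set"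
  assumes C: "vec.subspace C"
  shows "card C * card (euclidean_dual C) = (p ^ h) ^ CARD('n)"
proof -
  have dual_UNIV: "x \<in> euclidean_dual (UNIV :: ('a ^ 'n) set) \<longleftrightarrow> x = 0" for x
  proof
    assume "x \<in> euclidean_dual UNIV"
    then have "x $ i = 0" for i
      using dot_axis[of x i] by (simp add: mem_euclidean_dual)
    then show "x = 0"
      by (simp add: vec_eq_iff)
  qed (simp add: mem_euclidean_dual)
  have "complex_of_nat (card C * card (euclidean_dual C)) = (\<Sum>x\<in>UNIV. \<Sum>y\<in>C. chi (dot x y))"
    by (simp add: character_sum[OF C] sum.If_cases)
  also have "\<dots> = (\<Sum>y\<in>C. \<Sum>x\<in>UNIV. chi (dot y x))"
    by (subst sum.swap) (simp add: dot_commute)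
  also have "\<dots> = (\<Sum>y\<in>C. if y = 0 then of_nat CARD('a ^ 'n) else 0)"
    by (simp add: character_sum[OF vec.subspace_UNIV] dual_UNIV)
  also have "\<dots> = complex_of_nat (CARD('a ^ 'n))"
    using vec.subspace_0[OF C] by simp
  finally show ?thesis
    by (simp only: of_nat_eq_iff) (simp add: card_field CARD_vec)
qed

end

section \<open>Stabilizer codes from Euclidean self-orthogonal codes\<close>

context galois_field
begin

section \<open>Errors as transformations of amplitudes\<close>

lemma mat_mult_vec: "mat z *v u = z *s (u :: complex ^ 'm::finite)"
  by (simp add: vec_eq_iff mat_def matrix_vector_mult_def mult_delta_left)

lemma tensor_shift_mult_vec:
  fixes a :: "'a ^ 'n::finite"
  shows "(tensor_op (\<lambda>i. shift_op (a $ i)) *v u) $ y = u $ (y - a)"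
proof -
  have "tensor_op (\<lambda>i. shift_op (a $ i)) $ y $ x = (if x = y - a then 1 else 0)" for x
    by (simp add: tensor_op_def shift_op_def prod_if_zero vec_eq_iff algebra_simps)
  then show ?thesis
    by (simp add: matrix_vector_mult_def mult_delta_left)
qed

lemma tensor_phase_mult_vec:
  fixes b :: "'a ^ 'n::finite"
  shows "(tensor_op (\<lambda>i. phase_op p h (b $ i)) *v u) $ y = chi (dot b y) * u $ y"
proof -
  have "tensor_op (\<lambda>i. phase_op p h (b $ i)) $ y $ x = (if x = y then chi (dot b y) else 0)" for x
    by (auto simp: tensor_op_def phase_op_def prod_if_zero vec_eq_iff dot_def chi_sum
        simp flip: chi_def)
  then show ?thesis
    by (simp add: matrix_vector_mult_def mult_delta_left)
qed

text \<open>The phase factor is applied before the shift, so it is evaluated at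
  \<open>y - a\<close>, the place from which the amplitude comes.\<close>

lemma error_op_mult_vec:
  fixes a b :: "'a ^ 'n::finite"
  shows "(error_op p h k a b *v u) $ y = zeta p ^ k * chi (dot b (y - a)) * u $ (y - a)"
  by (simp add: error_op_def matrix_vector_mul_assoc [symmetric] mat_mult_vec
      tensor_shift_mult_vec tensor_phase_mult_vec)

lemma error_op_0: "error_op p h 0 0 0 = (mat 1 :: ('a ^ 'n::finite) operator)"
  by (simp add: matrix_eq vec_eq_iff error_op_mult_vec)

text \<open>Moving the phase part of the first error past the shift by \<open>a'\<close> costs the
  factor \<open>chi (dot b a')\<close>, which the assumption makes 1.\<close>

lemma error_op_mult:
  fixes a b a' b' :: "'a ^ 'n::finite"
  assumes "dot b a' = 0"
  shows "error_op p h 0 a b ** error_op p h 0 a' b' = error_op p h 0 (a + a') (b + b')"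
proof -
  have "chi (dot b (y - a)) * chi (dot b' (y - a - a')) = chi (dot (b + b') (y - (a + a')))" for y
    using assms by (simp add: dot_diff_right dot_add_left dot_add_right algebra_simps flip: chi_add)
  then show ?thesis
    by (simp add: matrix_eq vec_eq_iff error_op_mult_vec diff_diff_eq
        flip: matrix_vector_mul_assoc mult.assoc)
qed

end

text \<open>\<open>error_group\<close> is not itself shown to be a group, so the definite
  description behind \<open>m_inv\<close> is resolved directly by uniqueness of two-sided
  inverses.\<close>

lemma inv_matrix_monoid:
  fixes A B :: "'m::finite operator"
  assumes "monoid.mult G = (**)" "one G = mat 1" "A ** B = mat 1" "B ** A = mat 1" "B \<in> carrier G"
  shows "m_inv G A = B"
  unfolding m_inv_def
proof (rule the_equality)
  fix Y assume Y: "Y \<in> carrier G \<and> A \<otimes>\<^bsub>G\<^esub> Y = \<one>\<^bsub>G\<^esub> \<and> Y \<otimes>\<^bsub>G\<^esub> A = \<one>\<^bsub>G\<^esub>"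
  have "Y = Y ** (A ** B)"
    by (simp add: assms)
  also have "\<dots> = (Y ** A) ** B"
    by (rule matrix_mul_assoc)
  also have "\<dots> = B"
    using Y assms by simp
  finally show "Y = B" .
qed (use assms in auto)

lemma span_image_sum: "(\<Sum>x\<in>A. c x *s g x) \<in> vec.span (g ` A)"
  for g :: "'b \<Rightarrow> complex ^ 'm::finite"
proof (rule vec.span_sum)
  fix x assume "x \<in> A"
  then have "g x \<in> vec.span (g ` A)"
    by (intro vec.span_base imageI)
  then show "c x *s g x \<in> vec.span (g ` A)"
    by (rule vec.span_scale)
qed

section \<open>The stabilizer of a self-orthogonal code and its joint eigenspace\<close>

locale self_orthogonal_code = galois_field p h type
  for p h :: nat and type :: "'a::{field,finite} itself" +
  fixes C :: "('a ^ 'n::finite) set"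
  assumes subspace: "vec.subspace C"
    and self_orthogonal: "C \<subseteq> euclidean_dual C"
begin

abbreviation D :: "('a ^ 'n) set" where "D \<equiv> euclidean_dual C"

lemmas C_add = vec.subspace_add[OF subspace]
  and C_diff = vec.subspace_diff[OF subspace]
  and C_neg = vec.subspace_neg[OF subspace]
  and C_0 = vec.subspace_0[OF subspace]

lemmas D_add = vec.subspace_add[OF subspace_euclidean_dual[of C]]
  and D_diff = vec.subspace_diff[OF subspace_euclidean_dual[of C]]
  and D_0 = vec.subspace_0[OF subspace_euclidean_dual[of C]]

lemma dot_C: "a \<in> C \<Longrightarrow> b \<in> C \<Longrightarrow> dot a b = 0"
  using self_orthogonal by (auto simp: mem_euclidean_dual)

lemma dot_C_D: "b \<in> C \<Longrightarrow> x \<in> D \<Longrightarrow> dot b x = 0"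
  by (simp add: mem_euclidean_dual dot_commute[of b])

lemma card_C_pos: "card C > 0"
  using C_0 by (auto simp: card_gt_0_iff)

lemma D_diff_iff: "c \<in> C \<Longrightarrow> y - c \<in> D \<longleftrightarrow> y \<in> D"
  using self_orthogonal D_add[of "y - c" c] D_diff[of y c] by auto

text \<open>The exponent of \<open>zeta p\<close> can be kept at 0: for words of \<open>C\<close>
  the phases in \<open>error_op_mult\<close> are trivial, so the set is closed under
  products.\<close>

definition stab :: "('a ^ 'n) operator set" where
  "stab = {error_op p h 0 a b | a b. a \<in> C \<and> b \<in> C}"

definition code :: "('a ^ 'n) state set" where
  "code = {u. (\<forall>x. x \<notin> D \<longrightarrow> u $ x = 0) \<and> (\<forall>x. \<forall>a\<in>C. u $ (x - a) = u $ x)}"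

lemma stabI: "a \<in> C \<Longrightarrow> b \<in> C \<Longrightarrow> error_op p h 0 a b \<in> stab"
  by (auto simp: stab_def)

lemma stabE:
  assumes "E \<in> stab"
  obtains a b where "a \<in> C" "b \<in> C" "E = error_op p h 0 a b"
  using assms by (auto simp: stab_def)

lemma stab_mult:
  assumes "a \<in> C" "b \<in> C" "a' \<in> C" "b' \<in> C"
  shows "error_op p h 0 a b ** error_op p h 0 a' b' = error_op p h 0 (a + a') (b + b')"
  using assms by (intro error_op_mult dot_C)

lemma stab_one: "mat 1 \<in> stab"
  using stabI[OF C_0 C_0] by (simp add: error_op_0)

lemma stab_closed: "E \<in> stab \<Longrightarrow> E' \<in> stab \<Longrightarrow> E ** E' \<in> stab"
  by (elim stabE) (auto simp: stab_mult intro!: stabI C_add)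

lemma stab_inverse:
  assumes "E \<in> stab"
  obtains E' where "E' \<in> stab" "E ** E' = mat 1" "E' ** E = mat 1"
proof -
  obtain a b where E: "a \<in> C" "b \<in> C" "E = error_op p h 0 a b"
    using assms by (rule stabE)
  show ?thesis
    using E by (intro that[of "error_op p h 0 (- a) (- b)"])
      (auto simp: stab_mult C_neg error_op_0 intro!: stabI)
qed

lemma subgroup_stab: "subgroup stab (error_group p h)"
proof (rule subgroup.intro)
  show "stab \<subseteq> carrier (error_group p h)"
    by (auto simp: stab_def error_group_def)
next
  fix E assume E: "E \<in> stab"
  then obtain E' where "E' \<in> stab" "E ** E' = mat 1" "E' ** E = mat 1"
    by (rule stab_inverse)
  then show "inv\<^bsub>error_group p h\<^esub> E \<in> stab"
    by (subst inv_matrix_monoid[of _ _ E']) (auto simp: error_group_def stab_def)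
qed (auto simp: error_group_def stab_one stab_closed)

lemma comm_group_stab: "comm_group ((error_group p h)\<lparr>carrier := stab\<rparr>)"
proof (rule comm_groupI, goal_cases)
  \<comment> \<open>Goal 4 of \<open>comm_groupI\<close> is commutativity; goal 6 is the existence
    of left inverses.\<close>
  case (4 E E')
  then show ?case
    by (auto simp: error_group_def stab_mult add.commute elim!: stabE)
next
  case (6 E)
  then show ?case
    by (auto simp: error_group_def elim: stab_inverse)
qed (auto simp: error_group_def stab_one stab_closed matrix_mul_assoc)

text \<open>The pure phases (\<open>a = 0\<close>) force the support into \<open>D\<close>, since
  outside \<open>D\<close> one of them has a factor other than 1; the pure shifts
  (\<open>b = 0\<close>) force constancy on cosets.\<close>

lemma joint_eigenspace_stab: "joint_eigenspace stab = code"
proof (intro equalityI subsetI)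
  fix u assume u: "u \<in> joint_eigenspace stab"
  have eigen: "chi (dot b (y - a)) * u $ (y - a) = u $ y" if "a \<in> C" "b \<in> C" for a b y
  proof -
    have "error_op p h 0 a b *v u = u"
      using u stabI[OF that] by (simp add: joint_eigenspace_def)
    then show ?thesis
      using error_op_mult_vec[of 0 a b u y] by simp
  qed
  have "u $ x = 0" if "x \<notin> D" for x
  proof -
    obtain b where "b \<in> C" "chi (dot x b) \<noteq> 1"
      using ex_chi_dot_neq_1[OF subspace \<open>x \<notin> D\<close>] by blast
    then show ?thesis
      using eigen[OF C_0, of b x] by (auto simp: dot_commute)
  qed
  moreover have "u $ (x - a) = u $ x" if "a \<in> C" for x a
    using eigen[OF that C_0] by simp
  ultimately show "u \<in> code"
    by (simp add: code_def)
next
  fix u assume u: "u \<in> code"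
  have "error_op p h 0 a b *v u = u" if "a \<in> C" "b \<in> C" for a b
  proof (rule vec_eq_iff[THEN iffD2], rule allI)
    fix y
    show "(error_op p h 0 a b *v u) $ y = u $ y"
      using u that
      by (cases "y \<in> D") (auto simp: error_op_mult_vec code_def dot_C_D D_diff_iff)
  qed
  then show "u \<in> joint_eigenspace stab"
    by (auto simp: joint_eigenspace_def elim!: stabE)
qed

section \<open>A basis of the code: unnormalised uniform superpositions over the cosets of
  \<open>C\<close> in \<open>D\<close>\<close>

definition coset_state :: "'a ^ 'n \<Rightarrow> ('a ^ 'n) state" where
  "coset_state x = (\<chi> y. if y - x \<in> C then 1 else 0)"

lemma coset_state_nth: "coset_state x $ y = (if y - x \<in> C then 1 else 0)"
  by (simp add: coset_state_def)

lemma coset_state_in_code: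
  assumes "x \<in> D"
  shows "coset_state x \<in> code"
proof -
  have "y - x \<notin> C" if "y \<notin> D" for y
    using D_add[OF _ assms, of "y - x"] self_orthogonal that by auto
  moreover have "y - a - x \<in> C \<longleftrightarrow> y - x \<in> C" if "a \<in> C" for y a
    using C_add[OF _ that, of "y - a - x"] C_diff[OF _ that, of "y - x"] by (auto simp: algebra_simps)
  ultimately show ?thesis
    by (simp add: code_def coset_state_nth)
qed

lemma coset_state_eq_iff: "coset_state x = coset_state y \<longleftrightarrow> x - y \<in> C"
proof
  assume "coset_state x = coset_state y"
  then have "coset_state x $ x = coset_state y $ x"
    by simp
  then show "x - y \<in> C"
    using C_0 by (simp add: coset_state_nth split: if_splits)
next
  assume xy: "x - y \<in> C"
  have "z - x \<in> C \<longleftrightarrow> z - y \<in> C" for z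
    using C_add[OF _ xy, of "z - x"] C_diff[OF _ xy, of "z - y"] by auto
  then show "coset_state x = coset_state y"
    by (simp add: vec_eq_iff coset_state_nth)
qed

lemma code_neq_0: "code \<noteq> {0}"
proof -
  have "coset_state 0 $ 0 = 1"
    using C_0 by (simp add: coset_state_nth)
  then show ?thesis
    using coset_state_in_code[OF D_0] by (metis singletonD zero_index zero_neq_one)
qed

text \<open>Different coset states have disjoint supports, so reading a linear relation at position
  \<open>x\<close> isolates one coefficient.\<close>

lemma independent_coset_states: "vec.independent (coset_state ` D)"
proof (rule vec.independent_if_scalars_zero)
  fix f u
  assume sum: "(\<Sum>v\<in>coset_state ` D. f v *s v) = 0" and "u \<in> coset_state ` D"
  then obtain x where x: "u = coset_state x" "x \<in> D"
    by auto
  have "v $ x = (if v = u then 1 else 0)" if "v \<in> coset_state ` D" for v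
    using that x C_0 C_neg[of "x - y" for y]
    by (auto simp: coset_state_nth coset_state_eq_iff)
  then show "f u = 0"
    using arg_cong[OF sum, of "\<lambda>w. w $ x"] \<open>u \<in> coset_state ` D\<close>
    by (simp add: mult_delta_right)
qed simp

lemma span_coset_states: "code \<subseteq> vec.span (coset_state ` D)"
proof
  fix u assume u: "u \<in> code"
  \<comment> \<open>Summing over all of \<open>D\<close> avoids choosing representatives: every
    coset then occurs once per element, hence the division by \<open>card C\<close>.\<close>
  have "(\<Sum>x\<in>D. (u $ x / card C) * coset_state x $ y) = u $ y" for y
  proof -
    have "(\<Sum>x\<in>D. (u $ x / card C) * coset_state x $ y) = (\<Sum>x\<in>UNIV. if y - x \<in> C then u $ x / card C else 0)"
      using u by (intro sum.mono_neutral_cong_left) (auto simp: coset_state_nth code_def)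
    also have "\<dots> = (\<Sum>c\<in>UNIV. if c \<in> C then u $ (y - c) / card C else 0)"
      by (rule sum.reindex_bij_witness[of _ "\<lambda>c. y - c" "\<lambda>x. y - x"]) auto
    also have "\<dots> = (\<Sum>c\<in>C. u $ y / card C)"
      using u by (auto simp: code_def sum.If_cases intro!: sum.cong)
    also have "\<dots> = u $ y"
      using card_C_pos by (auto simp: card_gt_0_iff)
    finally show ?thesis .
  qed
  then have u_eq: "(\<Sum>x\<in>D. (u $ x / card C) *s coset_state x) = u"
    by (simp add: vec_eq_iff)
  show "u \<in> vec.span (coset_state ` D)"
    using span_image_sum[of "\<lambda>x. u $ x / card C" coset_state D] by (simp only: u_eq)
qed

text \<open>Every fibre of \<open>coset_state\<close> on \<open>D\<close> is a translate of
  \<open>C\<close>.\<close>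

lemma card_coset_states: "card (coset_state ` D) * card C = card D"
proof -
  have "card {x \<in> D. coset_state x = v} = card C" if v: "v \<in> coset_state ` D" for v
  proof -
    obtain y where y: "v = coset_state y" "y \<in> D"
      using v by auto
    have "{x \<in> D. coset_state x = v} = (+) y ` C"
    proof (intro equalityI subsetI)
      fix x assume "x \<in> {x \<in> D. coset_state x = v}"
      then show "x \<in> (+) y ` C"
        using y by (auto simp: coset_state_eq_iff intro!: image_eqI[of _ _ "x - y"])
    next
      fix x assume "x \<in> (+) y ` C"
      then show "x \<in> {x \<in> D. coset_state x = v}"
        using y self_orthogonal by (auto simp: coset_state_eq_iff intro: D_add)
    qed
    then show ?thesis
      by (simp add: card_image)
  qed
  then have "card (coset_state ` D) * card C = (\<Sum>v\<in>coset_state ` D. card {x \<in> D. coset_state x = v})"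
    by simp
  also have "\<dots> = card D"
    using sum.group[of D "coset_state ` D" coset_state "\<lambda>_. 1 :: nat"] by simp
  finally show ?thesis .
qed

lemma dim_code: "vec.dim code * card C = card D"
proof -
  have "coset_state ` D \<subseteq> code"
    using coset_state_in_code by auto
  then have "vec.dim code = card (coset_state ` D)"
    by (rule vec.dim_unique[OF _ span_coset_states independent_coset_states refl])
  then show ?thesis
    by (simp add: card_coset_states)
qed

section \<open>The orthogonal projector, which is the average of all elements of
  \<open>stab\<close>, and the detectable errors\<close>

definition proj :: "('a ^ 'n) operator" where
  "proj = (\<chi> y x. if x \<in> D \<and> y - x \<in> C then 1 / of_nat (card C) else 0)"

lemma proj_mult_vec:
  "(proj *v u) $ y = (if y \<in> D then (\<Sum>c\<in>C. u $ (y - c)) / card C else 0)"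
proof -
  have D_iff: "x \<in> D \<longleftrightarrow> y \<in> D" if "y - x \<in> C" for x
    using D_diff_iff[OF that, of y] by simp
  have "(proj *v u) $ y = (\<Sum>x\<in>UNIV. if x \<in> D \<and> y - x \<in> C then u $ x / card C else 0)"
    by (auto simp: proj_def matrix_vector_mult_def intro!: sum.cong)
  also have "\<dots> = (\<Sum>c\<in>UNIV. if c \<in> C then if y \<in> D then u $ (y - c) / card C else 0 else 0)"
    by (rule sum.reindex_bij_witness[of _ "\<lambda>c. y - c" "\<lambda>x. y - x"]) (auto simp: D_iff)
  finally show ?thesis
    by (simp add: sum.If_cases sum_divide_distrib)
qed

lemma proj_in_code: "proj *v u \<in> code"
proof -
  have "(\<Sum>c\<in>C. u $ (x - a - c)) = (\<Sum>c\<in>C. u $ (x - c))" if "a \<in> C" for x a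
    using that
    by (intro sum.reindex_bij_witness[of _ "\<lambda>c. c - a" "\<lambda>c. c + a"])
      (auto simp: algebra_simps intro: C_add C_diff)
  then show ?thesis
    by (simp add: code_def proj_mult_vec D_diff_iff)
qed

lemma proj_code: "u \<in> code \<Longrightarrow> proj *v u = u"
  using card_C_pos by (auto simp: vec_eq_iff proj_mult_vec code_def)

lemma orthogonal_projector_proj: "is_orthogonal_projector proj code"
  unfolding is_orthogonal_projector_def
proof (intro conjI allI)
  show "proj ** proj = proj"
    by (simp add: matrix_eq matrix_vector_mul_assoc [symmetric] proj_code proj_in_code)
next
  fix x y
  have "y \<in> D \<and> x - y \<in> C \<longleftrightarrow> x \<in> D \<and> y - x \<in> C"
    using C_neg[of "x - y"] C_neg[of "y - x"] D_diff_iff[of "y - x" y] D_diff_iff[of "x - y" x] by auto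
  then show "proj $ x $ y = cnj (proj $ y $ x)"
    by (simp add: proj_def)
next
  show "range ((*v) proj) = code"
    using proj_in_code proj_code by (metis (no_types, lifting) image_subset_iff rangeI subsetI subset_antisym)
qed

text \<open>Up to the scalar \<open>zeta p ^ k\<close> the error lies in \<open>stab\<close>, so on
  the code it acts as that scalar.\<close>

lemma detectable_stabilizer_coset:
  assumes "a \<in> C" "b \<in> C"
  shows "detectable code (error_op p h k a b)"
proof -
  have "error_op p h k a b *v u = (zeta p ^ k) *s u" if u: "u \<in> code" for u
  proof (rule vec_eq_iff[THEN iffD2], rule allI)
    fix y
    show "(error_op p h k a b *v u) $ y = ((zeta p ^ k) *s u) $ y"
      using u assms by (cases "y \<in> D") (auto simp: error_op_mult_vec code_def dot_C_D D_diff_iff)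
  qed
  then have "proj ** error_op p h k a b ** proj = mat (zeta p ^ k) ** proj"
    by (simp add: matrix_eq matrix_vector_mul_assoc [symmetric] proj_in_code proj_code mat_mult_vec
        vec.scale)
  then show ?thesis
    unfolding detectable_def using orthogonal_projector_proj by blast
qed

text \<open>The error followed by the projection kills the code: a shift outside \<open>D\<close>
  moves the support off \<open>D\<close>, and a phase outside \<open>D\<close> averages to zero over
  each coset of \<open>C\<close>.\<close>

lemma detectable_noncommuting:
  assumes "a \<notin> D \<or> b \<notin> D"
  shows "detectable code (error_op p h k a b)"
proof -
  have "(proj *v (error_op p h k a b *v u)) $ y = 0" if u: "u \<in> code" for u y
  proof (cases "a \<in> D \<and> y \<in> D")
    case False
    then have "u $ (y - c - a) = 0" if "y \<in> D" "c \<in> C" for c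
      using u that D_diff[of "y - c" "y - c - a"] by (auto simp: code_def D_diff_iff)
    then show ?thesis
      by (auto simp: proj_mult_vec error_op_mult_vec)
  next
    case True
    then have "b \<notin> D"
      using assms by blast
    have "- b \<notin> D"
      using \<open>b \<notin> D\<close> vec.subspace_neg[OF subspace_euclidean_dual, of "- b" C] by auto
    have u_inv: "u $ (y - c - a) = u $ (y - a)" if "c \<in> C" for c
      using u that by (auto simp: code_def algebra_simps) (metis diff_diff_eq diff_diff_eq2 add.commute)
    \<comment> \<open>On the coset the amplitude of \<open>u\<close> is constant and only the phase
      varies. The projector averages at \<open>y - c\<close>, hence the character of
      \<open>- b\<close>.\<close>
    have "(\<Sum>c\<in>C. (error_op p h k a b *v u) $ (y - c)) =
      (\<Sum>c\<in>C. zeta p ^ k * u $ (y - a) * chi (dot b (y - a)) * chi (dot (- b) c))"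
    proof (rule sum.cong[OF refl])
      fix c assume c: "c \<in> C"
      have "dot b (y - c - a) = dot b (y - a) + dot (- b) c"
        by (simp add: dot_diff_right dot_uminus_left)
      then show "(error_op p h k a b *v u) $ (y - c) =
        zeta p ^ k * u $ (y - a) * chi (dot b (y - a)) * chi (dot (- b) c)"
        by (simp add: error_op_mult_vec u_inv[OF c] chi_add)
    qed
    also have "\<dots> = 0"
      using \<open>- b \<notin> D\<close> by (simp add: character_sum[OF subspace] flip: sum_distrib_left)
    finally show ?thesis
      by (simp add: proj_mult_vec)
  qed
  then have "proj ** error_op p h k a b ** proj = mat 0 ** proj"
    by (simp add: matrix_eq matrix_vector_mul_assoc [symmetric] proj_in_code mat_mult_vec vec_eq_iff)
  then show ?thesis
    unfolding detectable_def using orthogonal_projector_proj by blast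
qed

text \<open>The shift carries the coset state of \<open>C\<close> to that of another coset inside
  \<open>D\<close>: it preserves the code without acting on it as a scalar.\<close>

lemma not_detectable_shift:
  assumes x: "x \<in> D - C"
  shows "\<not> detectable code (error_op p h 0 x 0)"
proof
  assume "detectable code (error_op p h 0 x 0)"
  then obtain P c where P: "P ** P = P" "range ((*v) P) = code"
    and c: "P ** error_op p h 0 x 0 ** P = mat c ** P"
    by (auto simp: detectable_def is_orthogonal_projector_def)
  \<comment> \<open>The projector in \<open>detectable\<close> is existentially quantified, so the
    argument must work for any idempotent with range \<open>code\<close>, not just for
    \<open>proj\<close>.\<close>
  have P_code: "P *v u = u" if u: "u \<in> code" for u
  proof -
    obtain w where "u = P *v w"
      using P(2) u by blast
    then show ?thesis
      using P(1) by (simp add: matrix_vector_mul_assoc)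
  qed
  have "error_op p h 0 x 0 *v coset_state 0 = coset_state x"
    by (simp add: vec_eq_iff error_op_mult_vec coset_state_nth)
  moreover have "(P ** error_op p h 0 x 0 ** P) *v coset_state 0 = (mat c ** P) *v coset_state 0"
    using c by simp
  ultimately have "coset_state x = c *s coset_state 0"
    using x by (simp add: matrix_vector_mul_assoc [symmetric] P_code coset_state_in_code D_0 mat_mult_vec)
  then have "coset_state x $ x = c * coset_state 0 $ x"
    by simp
  then show False
    using x C_0 by (simp add: coset_state_nth)
qed

section \<open>The minimum distance and the code parameters\<close>

lemma hamming_weight_le_error_weight:
  "hamming_weight a \<le> error_weight a b" "hamming_weight b \<le> error_weight a b"
  unfolding hamming_weight_def error_weight_def by (auto intro!: card_mono)

text \<open>An undetectable error has \<open>a\<close> and \<open>b\<close> in \<open>D\<close> but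
  not both in \<open>C\<close>, so one of them lies in \<open>D - C\<close> and bounds the error
  weight from below. A pure shift by a lightest word of \<open>D - C\<close> attains the
  bound.\<close>

lemma min_distance_code:
  assumes "D \<noteq> C"
  shows "is_min_distance p h code (min_weight (D - C))"
proof -
  have minus_0: "D - C - {0} = D - C"
    using C_0 by auto
  have min_le: "min_weight (D - C) \<le> hamming_weight x" if "x \<in> D - C" for x
    unfolding min_weight_def minus_0 using that by (intro Min_le) auto
  have "min_weight (D - C) \<in> hamming_weight ` (D - C)"
    unfolding min_weight_def minus_0 using assms self_orthogonal by (intro Min_in) auto
  then obtain x where x: "x \<in> D - C" "hamming_weight x = min_weight (D - C)"
    by (metis imageE)
  have "detects_below p h code (min_weight (D - C))"
    unfolding detects_below_def
  proof (intro allI impI)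
    fix k and a b :: "'a ^ 'n"
    assume weight: "error_weight a b < min_weight (D - C)"
    have "a \<notin> D - C" "b \<notin> D - C"
      using min_le[of a] min_le[of b] hamming_weight_le_error_weight[of a b]
        hamming_weight_le_error_weight[of b a] weight by force+
    then show "detectable code (error_op p h k a b)"
      using detectable_stabilizer_coset detectable_noncommuting by blast
  qed
  moreover have "d \<le> min_weight (D - C)" if d: "detects_below p h code d" for d
  proof (rule ccontr)
    assume "\<not> d \<le> min_weight (D - C)"
    moreover have "error_weight x 0 = min_weight (D - C)"
      using x(2) by (simp add: error_weight_def hamming_weight_def)
    ultimately have "detectable code (error_op p h 0 x 0)"
      using d by (simp add: detects_below_def)
    then show False
      using not_detectable_shift x(1) by blast
  qed
  ultimately show ?thesis
    by (simp add: is_min_distance_def)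
qed

theorem quantum_stabilizer_code_code:
  assumes card_C: "card C = (p ^ h) ^ k" and n: "CARD('n) = 2 * k + K" and "K > 0"
  shows "quantum_stabilizer_code p h CARD('n) K (min_weight (D - C)) code"
proof -
  have q: "p ^ h > 1"
    using p_gt_1 h_pos one_less_power by blast
  have q_pow: "(p ^ h) ^ k > 0"
    using p_gt_1 by simp
  have "(p ^ h) ^ k * card D = (p ^ h) ^ CARD('n)"
    using card_euclidean_dual[OF subspace] by (simp only: card_C)
  also have "\<dots> = (p ^ h) ^ k * (p ^ h) ^ (k + K)"
    by (simp only: n mult_2 power_add add.assoc)
  finally have card_D: "card D = (p ^ h) ^ (k + K)"
    by (rule nat_mult_eq_cancel1[OF q_pow, THEN iffD1])
  \<comment> \<open>Here \<open>K > 0\<close> enters: \<open>D\<close> is strictly larger than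
    \<open>C\<close>, so the minimum defining the distance ranges over a nonempty set.\<close>
  moreover have "(p ^ h) ^ (k + K) > (p ^ h) ^ k"
    using q \<open>K > 0\<close> by (intro power_strict_increasing) auto
  ultimately have "D \<noteq> C"
    using card_C by auto
  have "(p ^ h) ^ k * vec.dim code = card D"
    using dim_code by (simp only: card_C mult.commute)
  also have "\<dots> = (p ^ h) ^ k * (p ^ h) ^ K"
    by (simp only: card_D power_add)
  finally have "vec.dim code = (p ^ h) ^ K"
    by (rule nat_mult_eq_cancel1[OF q_pow, THEN iffD1])
  moreover have "is_stabilizer_code p h code"
    unfolding is_stabilizer_code_def
    using subgroup_stab comm_group_stab joint_eigenspace_stab code_neq_0 by blast
  ultimately show ?thesis
    unfolding quantum_stabilizer_code_def
    using min_distance_code[OF \<open>D \<noteq> C\<close>] card_field by blast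
qed

end

section \<open>Sums over the roots of a separable polynomial\<close>

lemma degree_prod_linear:
  "finite A \<Longrightarrow> degree (\<Prod>a\<in>A. [:- a, 1:]) = card (A :: 'a::field set)"
  by (subst degree_prod_sum_eq) auto

text \<open>\<open>f\<close> equals its Lagrange interpolant \<open>L\<close>, as the difference has
  more roots than its degree allows. Each basis product in \<open>L\<close> is monic of degree
  \<open>card A - 1\<close>, so the top coefficient is the sum of the weights.\<close>

lemma coeff_eq_sum_over_points:
  fixes f :: "'a::field poly"
  assumes A: "finite A" and deg: "degree f < card A"
  shows "poly.coeff f (card A - 1) = (\<Sum>a\<in>A. poly f a / (\<Prod>b\<in>A - {a}. a - b))"
proof -
  define w where "w a = poly f a / (\<Prod>b\<in>A - {a}. a - b)" for a
  define L where "L = (\<Sum>a\<in>A. smult (w a) (\<Prod>b\<in>A - {a}. [:- b, 1:]))"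
  have degree_prod: "degree (\<Prod>b\<in>A - {a}. [:- b, 1:]) = card A - 1" if "a \<in> A" for a
    using A that by (subst degree_prod_linear) auto
  have "poly L a = poly f a" if a: "a \<in> A" for a
  proof -
    have "poly L a = (\<Sum>x\<in>A. w x * (\<Prod>b\<in>A - {x}. a - b))"
      by (simp add: L_def poly_sum poly_prod)
    also have "\<dots> = (\<Sum>x\<in>{a}. w x * (\<Prod>b\<in>A - {x}. a - b))"
      using A a by (intro sum.mono_neutral_right) auto
    also have "\<dots> = poly f a"
      using A by (auto simp: w_def)
    finally show ?thesis .
  qed
  then have roots: "A \<subseteq> {x. poly (f - L) x = 0}"
    by auto
  have "degree L \<le> card A - 1"
    unfolding L_def
    by (intro degree_sum_le A order.trans[OF degree_smult_le]) (simp add: degree_prod)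
  then have "degree (f - L) < card A"
    using deg degree_diff_le_max[of f L] by linarith
  have "f - L = 0"
  proof (rule ccontr)
    assume nz: "f - L \<noteq> 0"
    have "card A \<le> card {x. poly (f - L) x = 0}"
      using roots by (intro card_mono poly_roots_finite nz)
    also have "\<dots> \<le> degree (f - L)"
      by (rule card_poly_roots_bound[OF nz])
    finally show False
      using \<open>degree (f - L) < card A\<close> by simp
  qed
  then have "poly.coeff f (card A - 1) = poly.coeff L (card A - 1)"
    by simp
  also have "\<dots> = (\<Sum>a\<in>A. w a)"
  proof -
    have "poly.coeff (\<Prod>b\<in>A - {a}. [:- b, 1:]) (card A - 1) = 1" if "a \<in> A" for a
      using lead_coeff_prod[of "\<lambda>b. [:- b, 1:]" "A - {a}"] degree_prod[OF that] by simp
    then show ?thesis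
      by (simp add: L_def coeff_sum)
  qed
  finally show ?thesis
    by (simp add: w_def)
qed

text \<open>A point occurring twice in the multiset of linear factors would be a common root of
  \<open>g\<close> and its derivative.\<close>

lemma splits_separable:
  assumes "splits g" "lead_coeff g = 1"
    and separable: "\<And>x. poly g x = 0 \<Longrightarrow> poly (pderiv g) x \<noteq> 0"
  shows "g = (\<Prod>a\<in>{x. poly g x = 0}. [:- a, 1:])"
proof -
  obtain M where g: "g = (\<Prod>a\<in>#M. [:- a, 1:])"
    using assms(1,2) by (auto simp: splits_def)
  have roots: "{x. poly g x = 0} = set_mset M"
    by (auto simp: g poly_prod_mset image_image prod_mset_zero_iff)
  have "count M a \<le> 1" for a
  proof (rule ccontr)
    assume "\<not> count M a \<le> 1"
    then have "a \<in># M" "a \<in># M - {#a#}"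
      by (auto simp: count_greater_zero_iff[symmetric] simp del: count_greater_zero_iff)
    then obtain N where "M = add_mset a (add_mset a N)"
      by (metis insert_DiffM)
    then have "g = [:- a, 1:] * ([:- a, 1:] * (\<Prod>a\<in>#N. [:- a, 1:]))"
      unfolding g by (simp only: image_mset_add_mset prod_mset.add_mset)
    then have "poly g a = 0" "poly (pderiv g) a = 0"
      by (simp_all only: pderiv_mult poly_mult poly_add) simp_all
    then show False
      using separable by blast
  qed
  then have "M = mset_set (set_mset M)"
    by (intro multiset_eqI)
      (metis One_nat_def count_greater_zero_iff count_mset_set(1) count_mset_set(3) finite_set_mset
        less_one not_gr_zero order_le_imp_less_or_eq)
  then show ?thesis
    unfolding roots by (metis g prod_unfold_prod_mset)
qed

text \<open>At a root \<open>a\<close> the derivative is the product of the differences from the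
  other roots, i.e. the Lagrange denominator. Since \<open>f\<close> may have the same degree as
  \<open>g\<close>, it is first reduced modulo \<open>g\<close>, which explains the second
  term.\<close>

lemma sum_over_roots:
  fixes g f :: "'a::field poly"
  assumes "splits g" "lead_coeff g = 1" "degree g = Suc n"
    and separable: "\<And>x. poly g x = 0 \<Longrightarrow> poly (pderiv g) x \<noteq> 0"
    and f: "degree f \<le> Suc n"
  shows "(\<Sum>a | poly g a = 0. poly f a / poly (pderiv g) a) =
    poly.coeff f n - poly.coeff f (Suc n) * poly.coeff g n"
proof -
  define A where "A = {x. poly g x = 0}"
  have "g \<noteq> 0"
    using assms(2) by auto
  then have "finite A"
    unfolding A_def by (rule poly_roots_finite)
  have g: "g = (\<Prod>a\<in>A. [:- a, 1:])"
    unfolding A_def using assms(1,2) separable by (rule splits_separable)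
  have card_A: "card A = Suc n"
    using degree_prod_linear[OF \<open>finite A\<close>] assms(3) g by simp
  have deriv: "poly (pderiv g) a = (\<Prod>b\<in>A - {a}. a - b)" if "a \<in> A" for a
  proof -
    have "poly (pderiv g) a = (\<Sum>x\<in>A. \<Prod>b\<in>A - {x}. a - b)"
      by (subst g) (simp add: pderiv_prod poly_sum poly_prod pderiv_pCons)
    also have "\<dots> = (\<Sum>x\<in>{a}. \<Prod>b\<in>A - {x}. a - b)"
      using \<open>finite A\<close> that by (intro sum.mono_neutral_right) auto
    finally show ?thesis
      by simp
  qed
  define R where "R = f - smult (poly.coeff f (Suc n)) g"
  have "degree R \<le> n"
  proof (rule degree_le, intro allI impI)
    fix i assume "n < i"
    show "poly.coeff R i = 0"
    proof (cases "i = Suc n")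
      case True
      then show ?thesis
        using assms(2,3) by (simp add: R_def)
    next
      case False
      then show ?thesis
        using \<open>n < i\<close> f assms(3) by (simp add: R_def coeff_eq_0)
    qed
  qed
  have "(\<Sum>a\<in>A. poly f a / poly (pderiv g) a) = (\<Sum>a\<in>A. poly R a / (\<Prod>b\<in>A - {a}. a - b))"
    by (intro sum.cong) (auto simp: deriv R_def A_def)
  also have "\<dots> = poly.coeff R n"
    using coeff_eq_sum_over_points[OF \<open>finite A\<close>, of R] \<open>degree R \<le> n\<close> card_A by simp
  finally show ?thesis
    by (simp add: A_def R_def)
qed

lemma coeff_mult_top:
  fixes f g :: "'a::comm_ring_1 poly"
  assumes "degree f \<le> Suc n" "degree g \<le> Suc n"
  shows "poly.coeff (f * g) (2 * n + 2) = poly.coeff f (Suc n) * poly.coeff g (Suc n)"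
    and "poly.coeff (f * g) (2 * n + 1) =
      poly.coeff f n * poly.coeff g (Suc n) + poly.coeff f (Suc n) * poly.coeff g n"
proof -
  have zero: "poly.coeff f i * poly.coeff g (k - i) = 0" if "i > Suc n \<or> k - i > Suc n" for i k
    using that assms by (auto simp: coeff_eq_0)
  have "poly.coeff (f * g) (2 * n + 2) = (\<Sum>i\<in>{Suc n}. poly.coeff f i * poly.coeff g (2 * n + 2 - i))"
    unfolding coeff_mult by (intro sum.mono_neutral_right ballI zero) auto
  then show "poly.coeff (f * g) (2 * n + 2) = poly.coeff f (Suc n) * poly.coeff g (Suc n)"
    by simp
  have "poly.coeff (f * g) (2 * n + 1) = (\<Sum>i\<in>{n, Suc n}. poly.coeff f i * poly.coeff g (2 * n + 1 - i))"
    unfolding coeff_mult by (intro sum.mono_neutral_right ballI zero) auto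
  then show "poly.coeff (f * g) (2 * n + 1) =
      poly.coeff f n * poly.coeff g (Suc n) + poly.coeff f (Suc n) * poly.coeff g n"
    by simp
qed

section \<open>The evaluation code\<close>

lemma ev_add: "ev \<alpha> v (f + g) = ev \<alpha> v f + ev \<alpha> v g"
  by (simp add: ev_def vec_eq_iff distrib_left)

lemma ev_smult: "ev \<alpha> v (smult k f) = k *s ev \<alpha> v f"
  by (simp add: ev_def vec_eq_iff mult_ac)

lemma ev_0: "ev \<alpha> v 0 = 0"
  by (simp add: ev_def vec_eq_iff)

text \<open>Two polynomials with the same image agree at \<open>CARD('n)\<close> distinct points,
  more than the degree of their difference.\<close>

lemma inj_on_ev:
  fixes \<alpha> v :: "'a::field ^ 'n::finite"
  assumes "inj (\<lambda>i. \<alpha> $ i)" "\<And>i. v $ i \<noteq> 0"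
  shows "inj_on (ev \<alpha> v) {f. degree f < CARD('n)}"
proof (rule inj_onI)
  fix f g :: "'a poly"
  assume deg: "f \<in> {f. degree f < CARD('n)}" "g \<in> {f. degree f < CARD('n)}"
    and "ev \<alpha> v f = ev \<alpha> v g"
  then have roots: "range (\<lambda>i. \<alpha> $ i) \<subseteq> {x. poly (f - g) x = 0}"
    using assms(2) by (auto simp: ev_def vec_eq_iff)
  show "f = g"
  proof (rule ccontr)
    assume "f \<noteq> g"
    then have nz: "f - g \<noteq> 0"
      by simp
    have "CARD('n) \<le> card {x. poly (f - g) x = 0}"
      using card_mono[OF poly_roots_finite[OF nz] roots] card_image[OF assms(1)] by simp
    also have "\<dots> \<le> degree (f - g)"
      by (rule card_poly_roots_bound[OF nz])
    finally show False
      using deg degree_diff_le_max[of f g] by auto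
  qed
qed

text \<open>
  The elements of \<open>S\<^sub>1\<close> for \<open>m = n + 3\<close>: the coefficients \<open>f\<close> at \<open>n\<close> and \<open>n + 1\<close> reappear
  as \<open>f\<^bsub>m-3\<^esub>\<close> and \<open>f\<^bsub>m-2\<^esub>\<close>.
\<close>

definition message_poly :: "nat \<Rightarrow> 'a::field \<Rightarrow> 'a \<Rightarrow> 'a \<Rightarrow> (nat \<Rightarrow> 'a) \<Rightarrow> 'a poly" where
  "message_poly n b \<eta> \<eta>' f = (\<Sum>i\<le>Suc n. monom (f i) i) +
     smult (f n * \<eta> + f (Suc n) * \<eta>') (monom (b / 2) (n + 2) + monom 1 (n + 3))"

lemma coeff_message_poly:
  "poly.coeff (message_poly n b \<eta> \<eta>' f) i =
    (if i \<le> Suc n then f i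
     else if i = n + 2 then (f n * \<eta> + f (Suc n) * \<eta>') * (b / 2)
     else if i = n + 3 then f n * \<eta> + f (Suc n) * \<eta>' else 0)"
  by (simp add: message_poly_def coeff_sum del: sum.atMost_Suc)

lemma degree_message_poly: "degree (message_poly n b \<eta> \<eta>' f) \<le> n + 3"
  by (rule degree_le) (simp add: coeff_message_poly)

lemma message_poly_add:
  "message_poly n b \<eta> \<eta>' f + message_poly n b \<eta> \<eta>' f' = message_poly n b \<eta> \<eta>' (\<lambda>i. f i + f' i)"
  by (simp add: poly_eq_iff coeff_message_poly algebra_simps add_divide_distrib)

lemma message_poly_smult:
  "smult k (message_poly n b \<eta> \<eta>' f) = message_poly n b \<eta> \<eta>' (\<lambda>i. k * f i)"
  by (simp add: poly_eq_iff coeff_message_poly algebra_simps)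

text \<open>Only the values of \<open>f\<close> up to \<open>n + 1\<close> matter, and they can be
  read back as low coefficients; extensional functions therefore serve as unique
  representatives.\<close>

lemma card_message_polys:
  "card (range (message_poly n b \<eta> \<eta>' :: (nat \<Rightarrow> 'a) \<Rightarrow> 'a poly)) = CARD('a::{field,finite}) ^ (n + 2)"
proof -
  let ?F = "PiE {..Suc n} (\<lambda>_. UNIV :: 'a set)"
  have "inj_on (message_poly n b \<eta> \<eta>') ?F"
  proof (rule inj_onI)
    fix f f' assume f: "f \<in> ?F" "f' \<in> ?F" and eq: "message_poly n b \<eta> \<eta>' f = message_poly n b \<eta> \<eta>' f'"
    have "f i = f' i" if "i \<le> Suc n" for i
      using arg_cong[OF eq, of "\<lambda>P. poly.coeff P i"] that by (simp add: coeff_message_poly)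
    then show "f = f'"
      using f by (intro PiE_ext) auto
  qed
  moreover have "message_poly n b \<eta> \<eta>' ` ?F = range (message_poly n b \<eta> \<eta>')"
  proof (intro equalityI subsetI)
    fix P assume "P \<in> range (message_poly n b \<eta> \<eta>')"
    then obtain f where "P = message_poly n b \<eta> \<eta>' f"
      by blast
    then have "P = message_poly n b \<eta> \<eta>' (restrict f {..Suc n})"
      by (simp add: poly_eq_iff coeff_message_poly)
    then show "P \<in> message_poly n b \<eta> \<eta>' ` ?F"
      by (rule image_eqI[where f = "message_poly n b \<eta> \<eta>'"]) (simp add: restrict_PiE_iff)
  qed auto
  ultimately have "card (range (message_poly n b \<eta> \<eta>')) = card ?F"
    using card_image by fastforce
  also have "\<dots> = CARD('a) ^ (n + 2)"
    by (simp add: card_PiE)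
  finally show ?thesis .
qed

text \<open>As \<open>2 * m\<close> is zero in the field, the derivative is a single monomial, whose
  only possible root is 0; that is no root of \<open>g\<close> because \<open>c\<close> is its
  constant term.\<close>

lemma separable_trinomial:
  fixes b c :: "'a::field"
  assumes g: "g = monom 1 (2 * m) + monom b (2 * m - 1) + monom c 0"
    and "m > 0" "of_nat (2 * m) = (0 :: 'a)" "b \<noteq> 0" "c \<noteq> 0"
  shows "pderiv g = monom (- b) (2 * m - 2)"
    and "degree g = 2 * m" "lead_coeff g = 1"
    and "poly g x = 0 \<Longrightarrow> x \<noteq> 0"
    and "poly g x = 0 \<Longrightarrow> poly (pderiv g) x \<noteq> 0"
proof -
  have "of_nat (2 * m - 1) = (- 1 :: 'a)"
    using assms(2,3) by (subst of_nat_diff) auto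
  then show deriv: "pderiv g = monom (- b) (2 * m - 2)"
    using assms(3) by (simp add: g pderiv_add pderiv_monom numeral_2_eq_2 del: of_nat_mult)
  show deg: "degree g = 2 * m"
  proof (rule order.antisym)
    show "degree g \<le> 2 * m"
      by (rule degree_le) (use \<open>m > 0\<close> in \<open>simp add: g\<close>)
    show "2 * m \<le> degree g"
      by (rule le_degree) (use \<open>m > 0\<close> in \<open>simp add: g\<close>)
  qed
  show "lead_coeff g = 1"
    unfolding deg using \<open>m > 0\<close> by (simp add: g)
  show nonzero: "x \<noteq> 0" if "poly g x = 0"
    using that \<open>m > 0\<close> \<open>c \<noteq> 0\<close> by (auto simp: g poly_monom power_0_left)
  show "poly (pderiv g) x \<noteq> 0" if "poly g x = 0"
    using nonzero[OF that] \<open>b \<noteq> 0\<close> by (simp add: deriv poly_monom)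
qed

lemma message_poly_self_orthogonal:
  fixes b c :: "'a::field" and n
  defines "m \<equiv> n + 3"
  assumes g: "g = monom 1 (2 * m) + monom b (2 * m - 1) + monom c 0"
    and char: "of_nat (2 * m) = (0 :: 'a)" "(2 :: 'a) \<noteq> 0" and bc: "b \<noteq> 0" "c \<noteq> 0"
    and "splits g"
  shows "(\<Sum>a | poly g a = 0. a powi (1 - int m) * poly (message_poly n b \<eta> \<eta>' f) a *
    (a powi (1 - int m) * poly (message_poly n b \<eta> \<eta>' f') a)) = 0"
proof -
  let ?P = "message_poly n b \<eta> \<eta>' f" and ?P' = "message_poly n b \<eta> \<eta>' f'"
  have "m > 0"
    by (simp add: m_def)
  note sep = separable_trinomial[OF g \<open>m > 0\<close> char(1) bc]
  have weight: "a powi (1 - int m) * a powi (1 - int m) = - b / poly (pderiv g) a"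
    if "poly g a = 0" for a
  proof -
    have "a powi (1 - int m) * a powi (1 - int m) = a powi (- int (2 * m - 2))"
      using sep(4)[OF that] \<open>m > 0\<close> by (subst power_int_add[symmetric]) (auto simp: of_nat_diff)
    also have "\<dots> = 1 / a ^ (2 * m - 2)"
      by (simp only: power_int_minus power_int_of_nat) (simp add: field_simps)
    finally show ?thesis
      using bc by (simp add: sep(1) poly_monom)
  qed
  have "(\<Sum>a | poly g a = 0. a powi (1 - int m) * poly ?P a * (a powi (1 - int m) * poly ?P' a)) =
    (\<Sum>a | poly g a = 0. - b * (poly (?P * ?P') a / poly (pderiv g) a))"
  proof (rule sum.cong[OF refl])
    fix a assume "a \<in> {a. poly g a = 0}"
    then have "a powi (1 - int m) * a powi (1 - int m) * (poly ?P a * poly ?P' a) =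
      - b / poly (pderiv g) a * (poly ?P a * poly ?P' a)"
      by (simp add: weight)
    then show "a powi (1 - int m) * poly ?P a * (a powi (1 - int m) * poly ?P' a) =
      - b * (poly (?P * ?P') a / poly (pderiv g) a)"
      by (simp add: mult_ac)
  qed
  \<comment> \<open>The product of two messages can have degree \<open>2 * m\<close>, the degree of
    \<open>g\<close>, so \<open>sum_over_roots\<close> is used with \<open>2 * m - 1\<close> for its
    \<open>n\<close>.\<close>
  also have "\<dots> = - b * (poly.coeff (?P * ?P') (2 * m - 1) -
      poly.coeff (?P * ?P') (Suc (2 * m - 1)) * poly.coeff g (2 * m - 1))"
  proof -
    have "degree (?P * ?P') \<le> Suc (2 * m - 1)"
      using degree_mult_le[of ?P ?P'] degree_message_poly[of n b \<eta> \<eta>' f]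
        degree_message_poly[of n b \<eta> \<eta>' f'] by (simp add: m_def)
    moreover have "degree g = Suc (2 * m - 1)"
      using sep(2) \<open>m > 0\<close> by simp
    ultimately show ?thesis
      by (simp only: sum_over_roots[OF \<open>splits g\<close> sep(3) _ sep(5)] flip: sum_distrib_left)
  qed
  also have "\<dots> = 0"
  proof -
    have deg: "degree ?P \<le> Suc (n + 2)" "degree ?P' \<le> Suc (n + 2)"
      using degree_message_poly[of n b \<eta> \<eta>'] by (simp_all add: eval_nat_numeral)
    have "Suc (2 * m - 1) = 2 * (n + 2) + 2" "2 * m - 1 = 2 * (n + 2) + 1"
      by (simp_all add: m_def)
    moreover have "poly.coeff g (2 * m - 1) = b"
      using \<open>m > 0\<close> by (simp add: g)
    \<comment> \<open>Needed when the denominators of the two terms with \<open>b / 2\<close> are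
      multiplied out.\<close>
    moreover have "(4 :: 'a) \<noteq> 0"
      using no_zero_divisors[OF char(2) char(2)] by simp
    ultimately show ?thesis
      using char(2) by (simp only: coeff_mult_top[OF deg]) (simp add: coeff_message_poly field_simps)
  qed
  finally show ?thesis .
qed

theorem proposition29:
  fixes p s h t r m :: nat
    and F :: "'a::{field,finite} set"
    and b c :: 'a
    and \<eta> :: "nat \<Rightarrow> nat \<Rightarrow> 'a"
    and g :: "'a poly"
    and \<alpha> v :: "'a ^ 'n::finite"
    and S1 :: "'a poly set"
    and C1 :: "('a ^ 'n) set"
  assumes "prime p" and "odd p"
    and "s > 0" and "h > 0" and "t > 0" and "r > 0"
    and "t dvd h" and "s \<le> h" and "gcd r p = 1"
    and "CARD('a) = p ^ h"
    and "subfield F (ring_of_type_algebra :: 'a ring)" and "card F = p ^ t"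
    and "b \<in> F" and "c \<in> F" and "b \<noteq> 0" and "c \<noteq> 0"
    and "m = r * p ^ s"
    and "g = monom 1 (2 * m) + monom b (2 * m - 1) + monom c 0"
    and "is_splitting_field F g"
    and "CARD('n) = 2 * m"
    and "range (\<lambda>i. \<alpha> $ i) = {x. poly g x = 0}"
    and "\<And>i. v $ i = \<alpha> $ i powi (1 - int m)"
    and "\<eta> 1 2 \<noteq> 0" and "\<eta> 2 2 \<noteq> 0"
    and "S1 = {(\<Sum>i=0..m-2. monom (f i) i) +
               (\<Sum>i=1..2. smult (f (m + i - 4) * \<eta> i 2)
                                (monom (b / 2) (m - 1) + monom 1 m)) | f. True}"
    and "C1 = ev \<alpha> v ` S1"
  shows "\<exists>Q :: ('a ^ 'n) state set.
           quantum_stabilizer_code p h (2 * m) 2 (min_weight (euclidean_dual C1 - C1)) Q"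
proof -
  interpret galois_field p h "TYPE('a)"
    by unfold_locales fact+
  have "p \<noteq> 2"
    using \<open>odd p\<close> by auto
  have "p \<ge> 3"
    using p_gt_1 \<open>p \<noteq> 2\<close> by linarith
  have "p dvd m"
    using \<open>m = r * p ^ s\<close> \<open>s > 0\<close> by (simp add: dvd_power)
  moreover have "m > 0"
    using \<open>m = r * p ^ s\<close> \<open>r > 0\<close> \<open>p \<ge> 3\<close> by simp
  \<comment> \<open>This bound keeps the natural-number differences \<open>m - 2\<close> and
    \<open>m + i - 4\<close> in \<open>S1\<close> from being truncated.\<close>
  ultimately have "m \<ge> 3"
    using \<open>p \<ge> 3\<close> dvd_imp_le[of p m] by linarith
  then obtain n where m: "m = n + 3"
    by (metis add.commute le_Suc_ex)
  have char: "of_nat (2 * m) = (0 :: 'a)"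
    using \<open>p dvd m\<close> by (simp only: of_nat_eq_0_iff_char_dvd CHAR_eq) (rule dvd_mult)
  have "\<not> p dvd 2"
    using \<open>p \<ge> 3\<close> by (auto dest: dvd_imp_le)
  then have two: "(2 :: 'a) \<noteq> 0"
    using of_nat_eq_0_iff_char_dvd[where ?'a = 'a, of 2] by (simp add: CHAR_eq)
  have "splits g"
    using \<open>is_splitting_field F g\<close> by (simp add: is_splitting_field_def)
  note sep = separable_trinomial[OF \<open>g = _\<close> \<open>m > 0\<close> char \<open>b \<noteq> 0\<close> \<open>c \<noteq> 0\<close>]

  \<comment> \<open>Separability yields as many roots as positions, so a word listing all the roots
    cannot repeat one.\<close>
  have "card {x. poly g x = 0} = 2 * m"
  proof -
    have "g \<noteq> 0"
      using sep(3) by auto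
    then show ?thesis
      using splits_separable[OF \<open>splits g\<close> sep(3) sep(5)] sep(2)
        degree_prod_linear[OF poly_roots_finite] by metis
  qed
  then have inj_\<alpha>: "inj (\<lambda>i. \<alpha> $ i)"
    using \<open>range _ = _\<close> \<open>CARD('n) = 2 * m\<close> by (intro eq_card_imp_inj_on) auto
  have \<alpha>_root: "poly g (\<alpha> $ i) = 0" for i
    using \<open>range _ = _\<close> by blast
  then have v_nz: "v $ i \<noteq> 0" for i
    using sep(4) by (simp add: \<open>\<And>i. v $ i = _\<close>)

  define M where "M = message_poly n b (\<eta> 1 2) (\<eta> 2 2)"
  have M_eq: "M f = (\<Sum>i=0..m-2. monom (f i) i) + (\<Sum>i=1..2. smult (f (m + i - 4) * \<eta> i 2)
      (monom (b / 2) (m - 1) + monom 1 m))" for f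
  proof -
    have "{0..m-2} = {..Suc n}" "{1..2 :: nat} = {1, 2}" "m + 1 - 4 = n" "m + 2 - 4 = Suc n"
      "m - 1 = n + 2"
      by (auto simp: m)
    then show ?thesis
      by (simp add: M_def message_poly_def m smult_add_left del: sum.atMost_Suc)
  qed
  have S1: "S1 = range M"
    unfolding \<open>S1 = _\<close> by (auto simp: M_eq)
  have C1: "x \<in> C1 \<longleftrightarrow> (\<exists>f. x = ev \<alpha> v (M f))" for x
    unfolding \<open>C1 = _\<close> S1 by auto

  interpret self_orthogonal_code p h "TYPE('a)" C1
  proof
    have "M f + M f' \<in> range M" "smult k (M f) \<in> range M" for f f' k
      by (simp_all add: M_def message_poly_add message_poly_smult)
    moreover have "0 \<in> ev \<alpha> v ` range M"
      using calculation(2)[of 0] by (metis ev_0 image_eqI smult_0_left)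
    ultimately show "vec.subspace C1"
      unfolding vec.subspace_def \<open>C1 = _\<close> S1
      by (auto simp: ev_add[symmetric] ev_smult[symmetric])
  next
    have "dot (ev \<alpha> v (M f)) (ev \<alpha> v (M f')) = 0" for f f'
    proof -
      have "dot (ev \<alpha> v (M f)) (ev \<alpha> v (M f')) =
        (\<Sum>i\<in>UNIV. \<alpha> $ i powi (1 - int m) * poly (M f) (\<alpha> $ i) *
          (\<alpha> $ i powi (1 - int m) * poly (M f') (\<alpha> $ i)))"
        by (simp add: dot_def ev_def \<open>\<And>i. v $ i = _\<close>)
      also have "\<dots> = (\<Sum>a | poly g a = 0. a powi (1 - int m) * poly (M f) a *
          (a powi (1 - int m) * poly (M f') a))"
        unfolding \<open>range _ = _\<close>[symmetric] by (subst sum.reindex[OF inj_\<alpha>]) simp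
      also have "\<dots> = 0"
        unfolding M_def m
        by (rule message_poly_self_orthogonal[OF \<open>g = _\<close>[unfolded m] char[unfolded m] two
              \<open>b \<noteq> 0\<close> \<open>c \<noteq> 0\<close> \<open>splits g\<close>])
      finally show ?thesis .
    qed
    then show "C1 \<subseteq> euclidean_dual C1"
      by (auto simp: mem_euclidean_dual C1)
  qed

  have "S1 \<subseteq> {f. degree f < CARD('n)}"
  proof
    fix P assume "P \<in> S1"
    then obtain f where "P = M f"
      unfolding S1 by blast
    then show "P \<in> {f. degree f < CARD('n)}"
      using degree_message_poly[of n b "\<eta> 1 2" "\<eta> 2 2" f] \<open>CARD('n) = 2 * m\<close> by (simp add: M_def m)
  qed
  then have "card C1 = card S1"
    unfolding \<open>C1 = _\<close> by (intro card_image inj_on_subset[OF inj_on_ev[OF inj_\<alpha> v_nz]])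
  also have "\<dots> = (p ^ h) ^ (n + 2)"
    unfolding S1 M_def by (simp add: card_message_polys card_field del: power_mult)
  \<comment> \<open>\<open>C1\<close> has dimension \<open>n + 2\<close>, that is m - 1, and 2m =
    2(m - 1) + 2 leaves 2 for \<open>K\<close>.\<close>
  finally have "quantum_stabilizer_code p h CARD('n) 2 (min_weight (euclidean_dual C1 - C1)) code"
    using \<open>CARD('n) = 2 * m\<close> by (intro quantum_stabilizer_code_code[where k = "n + 2"]) (simp_all add: m)
  then show ?thesis
    unfolding \<open>CARD('n) = 2 * m\<close> by blast
qed

end
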